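(* For integers $N\ge2$, the lower and upper critical couplings $\gamma_{\min}(N)$ and $\gamma_{\max}(N)$ of the Kuramoto model satisfy $$\gamma_{\min}(N)=\begin{cases}2N^{-3/2},&N\text{ even},\\ 2N^{-3/2}+O(N^{-5/2}),&N\text{ odd},\end{cases}$$ (the $O$-term being as $N\to\infty$ through odd integers), and $$\frac{1}{\sqrt{N(N-1)}}\le\gamma_{\max}(N)\le\frac{\sqrt2}{\sqrt{N(N-1)}} .$$
   Context: Consider the Kuramoto system $\frac{d}{dt}\theta=\omega+\gamma f(\theta)$ on $\mathbb{T}^N=(\mathbb{R}/2\pi\mathbb{Z})^N$, with $f_i(\theta)=\sum_{j=1}^N\sin(\theta_j-\theta_i)$, coupling $\gamma>0$, and frequency vector $\omega\in\mathbb{R}^N$ with $\sum_i\omega_i=0$. A fully synchronous solution is a $\theta\in\mathbb{T}^N$ with $\gamma f(\theta)=-\omega$ such that the Jacobian matrix $J(\theta)=\left(\partial f_i/\partial\theta_j\right)_{i,j}$ is negative semi-definite with a one-dimensional kernel. Let $\gamma^\star(\omega)$ be the minimal $\gamma$ for which a fully synchronous solution exists, understood as the infimum of all such $\gamma>0$. Define $$\gamma_{\min}(N)=\inf_{\omega}\gamma^\star(\omega),\qquad \gamma_{\max}(N)=\sup_{\omega}\gamma^\star(\omega),$$ both taken over all $\omega\in\mathbb{R}^N$ with Euclidean norm $|\omega|=1$ and $\sum_i\omega_i=0$. *)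

theory Defs
  imports
    "HOL-Analysis.Derivative"
    "HOL-Library.Extended_Real"
    "HOL-Library.Landau_Symbols"
    "Jordan_Normal_Form.Matrix_Kernel"
begin

unbundle no inner_syntax

(* Oscillators are indexed by 0, ..., N - 1.  A point of the torus (R / 2 pi Z)^N is given by a
   vector of real representatives of its angles.  The field and its Jacobian are 2 pi-periodic in
   every angle, so quantifying over points of the torus and over real lifts is the same. *)

definition kuramoto_field :: "nat \<Rightarrow> real vec \<Rightarrow> real vec" where
  "kuramoto_field N \<theta> = vec N (\<lambda>i. \<Sum>j<N. sin (\<theta> $ j - \<theta> $ i))"

definition kuramoto_jacobian :: "nat \<Rightarrow> real vec \<Rightarrow> real mat" where
  "kuramoto_jacobian N \<theta> =
     mat N N (\<lambda>(i, j). deriv (\<lambda>t. kuramoto_field N (\<theta> + t \<cdot>\<^sub>v unit_vec N j) $ i) 0)"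

definition negative_semidefinite :: "real mat \<Rightarrow> bool" where
  "negative_semidefinite A \<longleftrightarrow> (\<forall>v\<in>carrier_vec (dim_col A). v \<bullet> (A *\<^sub>v v) \<le> 0)"

definition fully_synchronous :: "nat \<Rightarrow> real \<Rightarrow> real vec \<Rightarrow> real vec \<Rightarrow> bool" where
  "fully_synchronous N \<gamma> \<omega> \<theta> \<longleftrightarrow>
     \<theta> \<in> carrier_vec N \<and>
     \<gamma> \<cdot>\<^sub>v kuramoto_field N \<theta> = - \<omega> \<and>
     negative_semidefinite (kuramoto_jacobian N \<theta>) \<and>
     kernel_dim (kuramoto_jacobian N \<theta>) = 1"

(* The critical couplings are extended reals, so that an infimum over no couplings and an unbounded
   supremum are infinite rather than unspecified reals. *)

definition critical_coupling :: "nat \<Rightarrow> real vec \<Rightarrow> ereal" where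
  "critical_coupling N \<omega> = (INF \<gamma>\<in>{\<gamma>. 0 < \<gamma> \<and> (\<exists>\<theta>. fully_synchronous N \<gamma> \<omega> \<theta>)}. ereal \<gamma>)"

definition unit_frequencies :: "nat \<Rightarrow> real vec set" where
  "unit_frequencies N =
     {\<omega> \<in> carrier_vec N. sqrt (\<Sum>i<N. (\<omega> $ i)\<^sup>2) = 1 \<and> (\<Sum>i<N. \<omega> $ i) = 0}"

definition gamma_min :: "nat \<Rightarrow> ereal" where
  "gamma_min N = (INF \<omega>\<in>unit_frequencies N. critical_coupling N \<omega>)"

definition gamma_max :: "nat \<Rightarrow> ereal" where
  "gamma_max N = (SUP \<omega>\<in>unit_frequencies N. critical_coupling N \<omega>)"

end

theory Submission
  imports Defs "HOL-Analysis.Function_Topology"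
begin

unbundle no inner_syntax
unbundle no vec_syntax

text \<open>For a unit frequency vector, a synchronous state \<open>\<theta>\<close> forces \<open>\<gamma> = 1 / |f(\<theta>)|\<close>.  With the order
  parameter \<open>C + i S = \<Sum>\<^sub>j exp (i \<theta>\<^sub>j)\<close> and \<open>R = C\<^sup>2 + S\<^sup>2\<close>, the Cauchy-Schwarz inequality gives
  \<open>|f(\<theta>)|\<^sup>2 \<le> N R - R\<^sup>2 / N \<le> N\<^sup>3 / 4\<close>, which bounds \<open>\<gamma>\<close> from below; two clusters of (nearly) equal
  size at an angle tending to \<open>\<pi> / 2\<close> approach equality.  For \<open>\<gamma>\<^sub>m\<^sub>a\<^sub>x\<close> the lower bound comes from a
  single oscillator opposing all the others, and the upper bound from the existence of an
  equilibrium with all phases within an open quarter circle as soon as \<open>\<gamma> N > max (\<omega>\<^sub>i - \<omega>\<^sub>k)\<close>, since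
  that maximum is at most \<open>\<surd>2\<close>.\<close>

section \<open>The vector field and its Jacobian as a weighted graph Laplacian\<close>

lemma kuramoto_field_carrier [simp]: "kuramoto_field N \<theta> \<in> carrier_vec N"
  by (simp add: kuramoto_field_def)

lemma dim_kuramoto_field [simp]: "dim_vec (kuramoto_field N \<theta>) = N"
  by (simp add: kuramoto_field_def)

lemma kuramoto_jacobian_carrier [simp]: "kuramoto_jacobian N \<theta> \<in> carrier_mat N N"
  by (simp add: kuramoto_jacobian_def)

lemma dim_kuramoto_jacobian [simp]:
  "dim_row (kuramoto_jacobian N \<theta>) = N" "dim_col (kuramoto_jacobian N \<theta>) = N"
  by (simp_all add: kuramoto_jacobian_def)

text \<open>On the diagonal the first term is \<open>cos 0 = 1\<close>; it cancels the summand
  \<open>k = i\<close>, so the sum can run over all \<open>k < N\<close>.\<close>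

lemma kuramoto_jacobian_index:
  assumes "\<theta> \<in> carrier_vec N" "i < N" "j < N"
  shows "kuramoto_jacobian N \<theta> $$ (i, j) =
    cos (\<theta> $ j - \<theta> $ i) - (if i = j then \<Sum>k<N. cos (\<theta> $ k - \<theta> $ i) else 0)"
proof -
  let ?d = "\<lambda>k. if k = j then 1 else 0 :: real"
  have eq: "kuramoto_field N (\<theta> + t \<cdot>\<^sub>v unit_vec N j) $ i =
      (\<Sum>k<N. sin ((\<theta> $ k + t * ?d k) - (\<theta> $ i + t * ?d i)))" for t
    using assms by (auto simp: kuramoto_field_def unit_vec_def intro!: sum.cong)
  have "((\<lambda>t. kuramoto_field N (\<theta> + t \<cdot>\<^sub>v unit_vec N j) $ i) has_field_derivative
      (\<Sum>k<N. cos (\<theta> $ k - \<theta> $ i) * (?d k - ?d i))) (at 0)"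
    unfolding eq by (auto intro!: derivative_eq_intros sum.cong)
  also have "(\<Sum>k<N. cos (\<theta> $ k - \<theta> $ i) * (?d k - ?d i)) =
      (\<Sum>k<N. if k = j then cos (\<theta> $ k - \<theta> $ i) else 0) -
      (if i = j then \<Sum>k<N. cos (\<theta> $ k - \<theta> $ i) else 0)"
    by (simp add: right_diff_distrib sum_subtractf)
       (simp add: if_distrib[where f = "(*) _"] cong: if_cong)
  also have "(\<Sum>k<N. if k = j then cos (\<theta> $ k - \<theta> $ i) else 0) = cos (\<theta> $ j - \<theta> $ i)"
    using assms by simp
  finally show ?thesis
    using assms by (simp add: kuramoto_jacobian_def DERIV_imp_deriv)
qed

text \<open>Every row of the Jacobian sums to zero, so it acts on differences of coordinates only:
  its negative is the Laplacian of the complete graph with edge weights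
  \<open>cos (\<theta> $ j - \<theta> $ i)\<close>.\<close>

lemma kuramoto_jacobian_mult_vec_index:
  assumes "\<theta> \<in> carrier_vec N" "v \<in> carrier_vec N" "i < N"
  shows "(kuramoto_jacobian N \<theta> *\<^sub>v v) $ i = (\<Sum>j<N. cos (\<theta> $ j - \<theta> $ i) * (v $ j - v $ i))"
proof -
  have "(kuramoto_jacobian N \<theta> *\<^sub>v v) $ i = (\<Sum>j<N. kuramoto_jacobian N \<theta> $$ (i, j) * v $ j)"
    using assms
    by (auto simp: scalar_prod_def atLeast0LessThan intro!: sum.cong)
  also have "\<dots> = (\<Sum>j<N. cos (\<theta> $ j - \<theta> $ i) * v $ j -
      (if j = i then (\<Sum>k<N. cos (\<theta> $ k - \<theta> $ i)) * v $ j else 0))"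
    using assms by (intro sum.cong) (auto simp: kuramoto_jacobian_index left_diff_distrib)
  also have "\<dots> = (\<Sum>j<N. cos (\<theta> $ j - \<theta> $ i) * v $ j) - (\<Sum>k<N. cos (\<theta> $ k - \<theta> $ i)) * v $ i"
    using assms by (simp add: sum_subtractf)
  finally show ?thesis
    by (simp add: right_diff_distrib sum_subtractf sum_distrib_right)
qed

text \<open>Averaging the double sum with its copy under the exchange of \<open>i\<close> and
  \<open>j\<close> produces squares, because the weights are symmetric.\<close>

lemma kuramoto_jacobian_quadratic_form:
  assumes "\<theta> \<in> carrier_vec N" "v \<in> carrier_vec N"
  shows "v \<bullet> (kuramoto_jacobian N \<theta> *\<^sub>v v) =
    - (\<Sum>i<N. \<Sum>j<N. cos (\<theta> $ j - \<theta> $ i) * (v $ j - v $ i)\<^sup>2) / 2"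
proof -
  let ?s = "\<Sum>i<N. \<Sum>j<N. cos (\<theta> $ j - \<theta> $ i) * (v $ i * (v $ j - v $ i))"
  have form: "v \<bullet> (kuramoto_jacobian N \<theta> *\<^sub>v v) = ?s"
    using assms
    by (auto simp: scalar_prod_def atLeast0LessThan kuramoto_jacobian_mult_vec_index
        sum_distrib_left mult_ac simp del: index_mult_mat_vec intro!: sum.cong)
  have "?s = (\<Sum>i<N. \<Sum>j<N. cos (\<theta> $ i - \<theta> $ j) * (v $ j * (v $ i - v $ j)))"
    by (rule sum.swap)
  then have "?s + ?s = (\<Sum>i<N. \<Sum>j<N. cos (\<theta> $ j - \<theta> $ i) * (v $ i * (v $ j - v $ i)) +
      cos (\<theta> $ i - \<theta> $ j) * (v $ j * (v $ i - v $ j)))"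
    by (simp add: sum.distrib)
  also have "\<dots> = (\<Sum>i<N. \<Sum>j<N. - (cos (\<theta> $ j - \<theta> $ i) * (v $ j - v $ i)\<^sup>2))"
  proof (intro sum.cong refl)
    fix i j
    have "cos (\<theta> $ i - \<theta> $ j) = cos (\<theta> $ j - \<theta> $ i)"
      by (metis cos_minus minus_diff_eq)
    then show "cos (\<theta> $ j - \<theta> $ i) * (v $ i * (v $ j - v $ i)) +
      cos (\<theta> $ i - \<theta> $ j) * (v $ j * (v $ i - v $ j)) = - (cos (\<theta> $ j - \<theta> $ i) * (v $ j - v $ i)\<^sup>2)"
      by (simp add: power2_eq_square algebra_simps)
  qed
  finally show ?thesis
    using form by (simp add: sum_negf)
qed

section \<open>Stability of states within an open quarter circle\<close>

lemma kernel_dim_eq_1I: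
  fixes A :: "'a :: field mat"
  assumes A: "A \<in> carrier_mat n m" and u: "u \<in> mat_kernel A" "u \<noteq> 0\<^sub>v m"
    and span: "\<And>v. v \<in> mat_kernel A \<Longrightarrow> \<exists>c. v = c \<cdot>\<^sub>v u"
  shows "kernel_dim A = 1"
proof -
  interpret kernel n m A by unfold_locales (rule A)
  have "Ker.span {u} = mat_kernel A"
  proof (intro equalityI subsetI)
    fix v assume "v \<in> Ker.span {u}"
    then show "v \<in> mat_kernel A"
      using Ker.span_is_subset2[of "{u}"] u by auto
  next
    fix v assume v: "v \<in> mat_kernel A"
    then obtain c where c: "v = c \<cdot>\<^sub>v u" using span by blast
    have uc: "u \<in> carrier_vec m" using mat_kernelD[OF A u(1)] by simp
    have "v = Ker.lincomb (\<lambda>_. c) {u}"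
      using u uc c by (auto simp: Ker.lincomb_def)
    then show "v \<in> Ker.span {u}"
      unfolding Ker.span_def by blast
  qed
  then show ?thesis
    using Ker.dim1I[of u] u by simp
qed

text \<open>All Laplacian weights are positive here, so the quadratic form is minus a sum of
  nonnegative terms and vanishes only on constant vectors.\<close>

lemma cohesive_jacobian:
  assumes \<theta>: "\<theta> \<in> carrier_vec N" and N: "0 < N"
    and cohesive: "\<And>i j. i < N \<Longrightarrow> j < N \<Longrightarrow> \<bar>\<theta> $ i - \<theta> $ j\<bar> < pi / 2"
  shows "negative_semidefinite (kuramoto_jacobian N \<theta>)"
    and "kernel_dim (kuramoto_jacobian N \<theta>) = 1"
proof -
  have cos_pos: "0 < cos (\<theta> $ j - \<theta> $ i)" if "i < N" "j < N" for i j
    using cohesive[OF that(2,1)] by (intro cos_gt_zero_pi) linarith+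
  have nonneg: "0 \<le> cos (\<theta> $ j - \<theta> $ i) * (v $ j - v $ i)\<^sup>2" if "i < N" "j < N" for i j v
    using cos_pos[OF that] by simp
  show "negative_semidefinite (kuramoto_jacobian N \<theta>)"
    unfolding negative_semidefinite_def
    using \<theta>
    by (auto simp: kuramoto_jacobian_quadratic_form nonneg intro!: sum_nonneg)
  let ?u = "vec N (\<lambda>_. 1 :: real)"
  show "kernel_dim (kuramoto_jacobian N \<theta>) = 1"
  proof (rule kernel_dim_eq_1I[OF kuramoto_jacobian_carrier, of ?u])
    show "?u \<in> mat_kernel (kuramoto_jacobian N \<theta>)"
      using \<theta>
      by (intro mat_kernelI[OF kuramoto_jacobian_carrier])
        (auto simp: kuramoto_jacobian_mult_vec_index simp del: index_mult_mat_vec intro!: eq_vecI)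
    show "?u \<noteq> 0\<^sub>v N"
      using N by (metis index_vec index_zero_vec(1) zero_neq_one)
    fix v assume "v \<in> mat_kernel (kuramoto_jacobian N \<theta>)"
    then have v: "v \<in> carrier_vec N" and "kuramoto_jacobian N \<theta> *\<^sub>v v = 0\<^sub>v N"
      using mat_kernelD[OF kuramoto_jacobian_carrier] by auto
    then have "(\<Sum>i<N. \<Sum>j<N. cos (\<theta> $ j - \<theta> $ i) * (v $ j - v $ i)\<^sup>2) = 0"
      using kuramoto_jacobian_quadratic_form[OF \<theta> v] by simp
    then have *: "(\<Sum>j<N. cos (\<theta> $ j - \<theta> $ i) * (v $ j - v $ i)\<^sup>2) = 0" if "i < N" for i
      using that by (subst (asm) sum_nonneg_eq_0_iff) (auto intro!: sum_nonneg nonneg)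
    \<comment> \<open>The row of oscillator \<open>0\<close> suffices, since the complete graph
      joins it to every other oscillator.\<close>
    have *: "cos (\<theta> $ j - \<theta> $ 0) * (v $ j - v $ 0)\<^sup>2 = 0" if "j < N" for j
      using *[OF N] that N nonneg by (subst (asm) sum_nonneg_eq_0_iff) auto
    have v_eq: "v $ j = v $ 0" if "j < N" for j
      using * [OF that] cos_pos[OF N that] by simp
    have "v = v $ 0 \<cdot>\<^sub>v ?u"
    proof (rule eq_vecI)
      fix j assume "j < dim_vec (v $ 0 \<cdot>\<^sub>v ?u)"
      then show "v $ j = (v $ 0 \<cdot>\<^sub>v ?u) $ j"
        using v_eq[of j] by simp
    qed (use v in simp)
    then show "\<exists>c. v = c \<cdot>\<^sub>v ?u" ..
  qed
qed

section \<open>Existence of cohesive equilibria by energy minimisation\<close>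

text \<open>The Kuramoto flow is the gradient descent of this energy, so its critical points are the
  equilibria. The double sum counts each pair twice, hence the factor
  \<open>\<gamma> / 2\<close>.\<close>

lemma kuramoto_energy_has_derivative:
  fixes x \<omega> :: "nat \<Rightarrow> real"
  assumes "k < N"
  shows "((\<lambda>t. - \<gamma> / 2 * (\<Sum>i<N. \<Sum>j<N. cos ((x(k := t)) i - (x(k := t)) j)) -
      (\<Sum>i<N. \<omega> i * (x(k := t)) i)) has_real_derivative
    \<gamma> * (\<Sum>j<N. sin (x k - x j)) - \<omega> k) (at (x k))"
proof -
  let ?d = "\<lambda>i. if i = k then 1 else 0 :: real"
  have upd: "((\<lambda>t. (x(k := t)) i) has_real_derivative ?d i) (at (x k))" for i
    by (cases "i = k") auto
  have "((\<lambda>t. - \<gamma> / 2 * (\<Sum>i<N. \<Sum>j<N. cos ((x(k := t)) i - (x(k := t)) j)) -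
      (\<Sum>i<N. \<omega> i * (x(k := t)) i)) has_real_derivative
    - \<gamma> / 2 * (\<Sum>i<N. \<Sum>j<N. - sin (x i - x j) * (?d i - ?d j)) - (\<Sum>i<N. \<omega> i * ?d i)) (at (x k))"
    by (rule derivative_eq_intros upd refl)+ (simp add: mult_ac)
  also have "(\<Sum>i<N. \<omega> i * ?d i) = \<omega> k"
    using assms by (simp add: if_distrib cong: if_cong)
  also have "(\<Sum>i<N. \<Sum>j<N. - sin (x i - x j) * (?d i - ?d j)) =
      (\<Sum>i<N. \<Sum>j<N. (if i = k then sin (x j - x k) else 0) + (if j = k then sin (x i - x k) else 0))"
  proof (intro sum.cong refl)
    fix i j
    show "- sin (x i - x j) * (?d i - ?d j) =
        (if i = k then sin (x j - x k) else 0) + (if j = k then sin (x i - x k) else 0)"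
      using sin_minus[of "x i - x j"] by auto
  qed
  also have "\<dots> = 2 * (\<Sum>j<N. sin (x j - x k))"
  proof -
    have "(\<Sum>i<N. \<Sum>j<N. if i = k then sin (x j - x k) else 0) =
        (\<Sum>i<N. if i = k then \<Sum>j<N. sin (x j - x k) else 0)"
      by (intro sum.cong) auto
    then show ?thesis
      using assms by (simp add: sum.distrib)
  qed
  also have "\<dots> = - 2 * (\<Sum>j<N. sin (x k - x j))"
    using sin_minus[of "x k - x j" for j] by (simp add: sum_negf[symmetric])
  finally show ?thesis
    by simp
qed

text \<open>Interactions cancel in pairs. This makes the partial derivatives of the energy sum to
  zero, and likewise the entries of the field.\<close>

lemma sum_sin_antisymmetric:
  fixes x :: "'a \<Rightarrow> real"
  shows "(\<Sum>i\<in>A. \<Sum>j\<in>A. sin (x i - x j)) = 0"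
proof -
  have "(\<Sum>i\<in>A. \<Sum>j\<in>A. sin (x i - x j)) = (\<Sum>i\<in>A. \<Sum>j\<in>A. sin (x j - x i))"
    by (rule sum.swap)
  also have "\<dots> = (\<Sum>i\<in>A. \<Sum>j\<in>A. - sin (x i - x j))"
    by (intro sum.cong refl) (metis minus_diff_eq sin_minus)
  finally show ?thesis
    by (simp add: sum_negf)
qed

lemma one_le_sin_plus_cos:
  fixes x :: real
  assumes "0 \<le> x" "x \<le> pi / 2"
  shows "1 \<le> sin x + cos x"
proof -
  have "0 \<le> sin x" "0 \<le> cos x"
    using assms by (auto intro!: sin_ge_zero cos_ge_zero)
  moreover have "(sin x + cos x)\<^sup>2 = 1\<^sup>2 + 2 * (sin x * cos x)"
    by (simp add: power2_sum)
  ultimately show ?thesis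
    by (intro power2_le_imp_le[of 1]) auto
qed

text \<open>Configurations are functions on all of \<open>nat\<close>, as \<open>N\<close> is not
  fixed by a type; compactness of the infinite box is Tychonoff's theorem.\<close>

lemma compact_box_nat_fun: "compact {x :: nat \<Rightarrow> real. \<forall>i. x i \<in> {a..b}}"
proof -
  have "{x :: nat \<Rightarrow> real. \<forall>i. x i \<in> {a..b}} = PiE UNIV (\<lambda>_. {a..b})"
    by (auto simp: PiE_def)
  moreover have "compactin (product_topology (\<lambda>_. euclidean) UNIV) (PiE UNIV (\<lambda>_ :: nat. {a..b}))"
    by (subst compactin_PiE) auto
  ultimately show ?thesis
    by (simp add: euclidean_product_topology)
qed

text \<open>Minimise the energy over the box \<open>[0, \<pi> / 2]\<^sup>N\<close>.  The minimiser cannot touch both the upper and the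
  lower faces of the box, because \<open>sin x + cos x \<ge> 1\<close> would then contradict the gap condition.  Hence
  all partial derivatives have the same sign, and they vanish because they sum to zero.\<close>

lemma exists_cohesive_equilibrium:
  fixes \<omega> :: "nat \<Rightarrow> real"
  assumes \<gamma>: "0 < \<gamma>" and sum0: "(\<Sum>i<N. \<omega> i) = 0"
    and gap: "\<And>i k. i < N \<Longrightarrow> k < N \<Longrightarrow> \<omega> i - \<omega> k < \<gamma> * N"
  obtains x where "\<And>i j. i < N \<Longrightarrow> j < N \<Longrightarrow> \<bar>x i - x j\<bar> < pi / 2"
    and "\<And>i. i < N \<Longrightarrow> \<gamma> * (\<Sum>j<N. sin (x i - x j)) = \<omega> i"
proof -
  define E where "E x = - \<gamma> / 2 * (\<Sum>i<N. \<Sum>j<N. cos (x i - x j)) - (\<Sum>i<N. \<omega> i * x i)"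
    for x :: "nat \<Rightarrow> real"
  let ?B = "{x :: nat \<Rightarrow> real. \<forall>i. x i \<in> {0..pi / 2}}"
  have coord: "continuous_on ?B (\<lambda>x. x i)" for i
    by (rule continuous_on_subset[OF continuous_on_product_coordinates]) simp
  have cont: "continuous_on ?B E"
    unfolding E_def
    by (intro continuous_intros coord continuous_on_compose2[OF continuous_on_cos[OF continuous_on_id, of UNIV]]) auto
  have "(\<lambda>_. 0) \<in> ?B"
    by simp
  then have "?B \<noteq> {}"
    by (metis empty_iff)
  from continuous_attains_inf[OF compact_box_nat_fun this cont]
  obtain x where x: "x \<in> ?B" and min: "\<And>y. y \<in> ?B \<Longrightarrow> E x \<le> E y"
    by metis
  define g where "g k = \<gamma> * (\<Sum>j<N. sin (x k - x j)) - \<omega> k" for k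
  have deriv: "((\<lambda>t. E (x(k := t))) has_real_derivative g k) (at (x k))" if "k < N" for k
    unfolding E_def g_def using kuramoto_energy_has_derivative[OF that] .
  \<comment> \<open>Off the lower face the coordinate may decrease within the box, so a positive
    derivative would contradict minimality.\<close>
  have g_le: "g k \<le> 0" if k: "k < N" "0 < x k" for k
  proof (rule ccontr)
    assume "\<not> g k \<le> 0"
    then obtain d where "0 < d" and d: "\<And>h. 0 < h \<Longrightarrow> h < d \<Longrightarrow> E (x(k := x k - h)) < E (x(k := x k))"
      using DERIV_pos_inc_left[OF deriv[OF k(1)]] by force
    \<comment> \<open>Halving \<open>d\<close> keeps the step strictly below \<open>d\<close>; the
      cap \<open>x k\<close> keeps the new point in the box.\<close>
    define h where "h = min (d / 2) (x k)"
    have "0 < h" "h < d" "h \<le> x k"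
      using \<open>0 < d\<close> k by (auto simp: h_def)
    moreover have "x k \<le> pi / 2"
      using x by simp
    ultimately have "x k - h \<le> pi / 2" "0 \<le> x k - h"
      by argo+
    then have "x(k := x k - h) \<in> ?B"
      using x by auto
    then show False
      using min d[OF \<open>0 < h\<close> \<open>h < d\<close>] by (metis fun_upd_triv not_le)
  qed
  have g_ge: "0 \<le> g k" if k: "k < N" "x k < pi / 2" for k
  proof (rule ccontr)
    assume "\<not> 0 \<le> g k"
    then obtain d where "0 < d" and d: "\<And>h. 0 < h \<Longrightarrow> h < d \<Longrightarrow> E (x(k := x k + h)) < E (x(k := x k))"
      using DERIV_neg_dec_right[OF deriv[OF k(1)]] by force
    define h where "h = min (d / 2) (pi / 2 - x k)"
    have "0 < h" "h < d" "x k + h \<le> pi / 2"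
      using \<open>0 < d\<close> k by (auto simp: h_def min_def field_simps)
    moreover have "0 \<le> x k"
      using x by simp
    ultimately have "0 \<le> x k + h"
      by argo
    then have "x(k := x k + h) \<in> ?B"
      using x \<open>x k + h \<le> pi / 2\<close> by auto
    then show False
      using min d[OF \<open>0 < h\<close> \<open>h < d\<close>] by (metis fun_upd_triv not_le)
  qed
  have not_both: False if i: "i < N" "x i = pi / 2" and k: "k < N" "x k = 0" for i k
  proof -
    have "1 \<le> sin (x j) + cos (x j)" for j
      using x by (intro one_le_sin_plus_cos) auto
    then have "real N \<le> (\<Sum>j<N. sin (x j) + cos (x j))"
      using sum_mono[of "{..<N}" "\<lambda>_. 1" "\<lambda>j. sin (x j) + cos (x j)"] by simp
    \<comment> \<open>With \<open>x i = pi / 2\<close> and \<open>x k = 0\<close>, the sines on the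
      right become \<open>cos (x j)\<close> and \<open>- sin (x j)\<close>.\<close>
    also have "\<dots> = (\<Sum>j<N. sin (x i - x j)) - (\<Sum>j<N. sin (x k - x j))"
      by (simp add: i k sum.distrib sum_negf sin_diff)
    finally have "\<gamma> * real N \<le> \<gamma> * ((\<Sum>j<N. sin (x i - x j)) - (\<Sum>j<N. sin (x k - x j)))"
      using \<gamma> by simp
    also have "\<dots> = g i - g k + \<omega> i - \<omega> k"
      by (simp add: g_def algebra_simps)
    also have "\<dots> \<le> \<omega> i - \<omega> k"
      using g_le[OF i(1)] g_ge[OF k(1)] i k by simp
    finally show False
      using gap[OF i(1) k(1)] by simp
  qed
  have sum_g: "(\<Sum>k<N. g k) = 0"
    using sum0 sum_sin_antisymmetric[of x "{..<N}"]
    by (simp add: g_def sum_subtractf sum_distrib_left[symmetric])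
  have "(\<forall>i<N. x i < pi / 2) \<or> (\<forall>k<N. 0 < x k)"
    using not_both x by (metis (no_types, lifting) atLeastAtMost_iff mem_Collect_eq order_le_less)
  then have g0: "g k = 0" if "k < N" for k
  proof
    assume "\<forall>i<N. x i < pi / 2"
    then show ?thesis
      using sum_g g_ge that by (subst (asm) sum_nonneg_eq_0_iff) auto
  next
    assume "\<forall>i<N. 0 < x i"
    moreover have "(\<Sum>k<N. - g k) = 0"
      using sum_g by (simp add: sum_negf)
    ultimately show ?thesis
      using g_le that by (subst (asm) sum_nonneg_eq_0_iff) auto
  qed
  show thesis
  proof
    show "\<gamma> * (\<Sum>j<N. sin (x i - x j)) = \<omega> i" if "i < N" for i
      using g0[OF that] by (simp add: g_def)
    \<comment> \<open>Within the box a difference of \<open>pi / 2\<close> needs one coordinate on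
      each of the opposite faces, which \<open>not_both\<close> excludes.\<close>
    show "\<bar>x i - x j\<bar> < pi / 2" if "i < N" "j < N" for i j
    proof -
      have "0 \<le> x i" "x i \<le> pi / 2" "0 \<le> x j" "x j \<le> pi / 2"
        using x by auto
      then show ?thesis
        using not_both[OF that(1) _ that(2)] not_both[OF that(2) _ that(1)]
        unfolding abs_less_iff by argo
    qed
  qed
qed

section \<open>Bounds for the upper critical coupling\<close>

text \<open>The gap condition yields a cohesive equilibrium, and cohesiveness supplies the Jacobian
  conditions, so \<open>\<gamma>\<close> itself lies in the set whose infimum is taken.\<close>

lemma critical_coupling_le:
  assumes "0 < N" "0 < \<gamma>" "\<omega> \<in> carrier_vec N" "(\<Sum>i<N. \<omega> $ i) = 0"
    and "\<And>i k. i < N \<Longrightarrow> k < N \<Longrightarrow> \<omega> $ i - \<omega> $ k < \<gamma> * N"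
  shows "critical_coupling N \<omega> \<le> ereal \<gamma>"
proof -
  obtain x where x: "\<And>i j. i < N \<Longrightarrow> j < N \<Longrightarrow> \<bar>x i - x j\<bar> < pi / 2"
      "\<And>i. i < N \<Longrightarrow> \<gamma> * (\<Sum>j<N. sin (x i - x j)) = \<omega> $ i"
    using exists_cohesive_equilibrium[where \<gamma> = \<gamma> and N = N and \<omega> = "\<lambda>i. \<omega> $ i"] assms by blast
  have "\<gamma> * (\<Sum>j<N. sin (x j - x i)) = - \<omega> $ i" if "i < N" for i
  proof -
    have "(\<Sum>j<N. sin (x j - x i)) = - (\<Sum>j<N. sin (x i - x j))"
      unfolding sum_negf[symmetric] by (intro sum.cong refl) (metis minus_diff_eq sin_minus)
    then show ?thesis
      using x(2)[OF that] by simp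
  qed
  then have "\<gamma> \<cdot>\<^sub>v kuramoto_field N (vec N x) = - \<omega>"
    using assms by (intro eq_vecI) (auto simp: kuramoto_field_def)
  then have "fully_synchronous N \<gamma> \<omega> (vec N x)"
    using cohesive_jacobian[of "vec N x" N] x(1) assms by (simp add: fully_synchronous_def)
  then show ?thesis
    unfolding critical_coupling_def using assms by (intro INF_lower) blast
qed

lemma gamma_max_le:
  assumes "2 \<le> N"
  shows "gamma_max N \<le> ereal (sqrt 2 / sqrt (real N * (real N - 1)))"
  unfolding gamma_max_def
proof (rule SUP_least, rule critical_coupling_le)
  fix \<omega> assume "\<omega> \<in> unit_frequencies N"
  then have \<omega>: "\<omega> \<in> carrier_vec N" "(\<Sum>i<N. (\<omega> $ i)\<^sup>2) = 1" "(\<Sum>i<N. \<omega> $ i) = 0"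
    by (auto simp: unit_frequencies_def)
  show "\<omega> \<in> carrier_vec N" "(\<Sum>i<N. \<omega> $ i) = 0" by fact+
  show "0 < N" "0 < sqrt 2 / sqrt (real N * (real N - 1))"
    using assms by auto
  fix i k assume ik: "i < N" "k < N"
  have "\<omega> $ i - \<omega> $ k \<le> sqrt 2"
  proof (cases "i = k")
    case False
    have "(\<Sum>j\<in>{i, k}. (\<omega> $ j)\<^sup>2) \<le> (\<Sum>j<N. (\<omega> $ j)\<^sup>2)"
      using ik by (intro sum_mono2) auto
    then have "(\<omega> $ i)\<^sup>2 + (\<omega> $ k)\<^sup>2 \<le> 1"
      using False \<omega> by simp
    \<comment> \<open>Parallelogram identity: two coordinates of a unit vector differ by at most
      \<open>sqrt 2\<close>.\<close>
    moreover have "(\<omega> $ i - \<omega> $ k)\<^sup>2 + (\<omega> $ i + \<omega> $ k)\<^sup>2 = 2 * ((\<omega> $ i)\<^sup>2 + (\<omega> $ k)\<^sup>2)"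
      by (simp add: power2_eq_square algebra_simps)
    moreover have "(\<omega> $ i - \<omega> $ k)\<^sup>2 \<le> (\<omega> $ i - \<omega> $ k)\<^sup>2 + (\<omega> $ i + \<omega> $ k)\<^sup>2"
      by simp
    ultimately have "(\<omega> $ i - \<omega> $ k)\<^sup>2 \<le> 2"
      by argo
    then show ?thesis
      by (rule real_le_rsqrt)
  qed simp
  \<comment> \<open>The claimed bound exceeds \<open>sqrt 2 / N\<close>, which gives the strictness
    that the gap condition demands.\<close>
  also have "sqrt 2 < sqrt 2 / sqrt (real N * (real N - 1)) * N"
  proof -
    have "sqrt (real N * (real N - 1)) < N"
      using assms by (intro real_less_lsqrt) (auto simp: power2_eq_square)
    then show ?thesis
      using assms by (simp add: field_simps)
  qed
  finally show "\<omega> $ i - \<omega> $ k < sqrt 2 / sqrt (real N * (real N - 1)) * N" .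
qed

lemma gamma_max_ge:
  assumes N: "2 \<le> N"
  shows "ereal (1 / sqrt (real N * (real N - 1))) \<le> gamma_max N"
proof -
  define s where "s = sqrt (real N * (real N - 1))"
  have s: "0 < s" "s\<^sup>2 = real N * (real N - 1)"
    using N by (auto simp: s_def)
  \<comment> \<open>Oscillator \<open>0\<close> opposes all the others; \<open>s\<close> normalises,
    as \<open>(N - 1)^2 + (N - 1) = N (N - 1)\<close>.\<close>
  define \<omega> where "\<omega> = vec N (\<lambda>i. if i = 0 then (real N - 1) / s else - 1 / s)"
  have split: "{..<N} = insert 0 {1..<N}"
    using N by auto
  have "(\<Sum>i<N. (\<omega> $ i)\<^sup>2) = ((real N - 1) / s)\<^sup>2 + (real N - 1) * (1 / s)\<^sup>2"
    using N by (simp add: \<omega>_def split of_nat_diff)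
  also have "\<dots> = 1"
    using s N by (simp add: power_divide divide_simps) (simp add: power2_eq_square algebra_simps)
  finally have "\<omega> \<in> unit_frequencies N"
    using N by (simp add: unit_frequencies_def) (simp add: \<omega>_def split of_nat_diff)
  moreover have "ereal (1 / s) \<le> critical_coupling N \<omega>"
    unfolding critical_coupling_def
  proof (rule INF_greatest, clarify)
    fix \<gamma> :: real and \<theta> assume "0 < \<gamma>" "fully_synchronous N \<gamma> \<omega> \<theta>"
    then have "(\<gamma> \<cdot>\<^sub>v kuramoto_field N \<theta>) $ 0 = (- \<omega>) $ 0"
      by (simp add: fully_synchronous_def)
    then have "(real N - 1) / s = \<gamma> * - (\<Sum>j<N. sin (\<theta> $ j - \<theta> $ 0))"
      using N by (simp add: kuramoto_field_def \<omega>_def)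
    \<comment> \<open>Dropping the zero term \<open>j = 0\<close> leaves \<open>N - 1\<close> sines,
      and this factor cancels against the numerator of \<open>\<omega> $ 0\<close>.\<close>
    also have "- (\<Sum>j<N. sin (\<theta> $ j - \<theta> $ 0)) = (\<Sum>j\<in>{1..<N}. - sin (\<theta> $ j - \<theta> $ 0))"
      by (simp add: split sum_negf)
    also have "\<gamma> * \<dots> \<le> \<gamma> * (\<Sum>j\<in>{1..<N}. 1)"
      using \<open>0 < \<gamma>\<close> by (intro mult_left_mono sum_mono) (auto simp: minus_le_iff)
    finally have "(real N - 1) * (1 / s) \<le> (real N - 1) * \<gamma>"
      using N by (simp add: of_nat_diff mult_ac)
    then show "ereal (1 / s) \<le> ereal \<gamma>"
      using N by (subst (asm) mult_le_cancel_left_pos) auto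
  qed
  ultimately show ?thesis
    unfolding gamma_max_def s_def by (rule SUP_upper2)
qed

section \<open>Lower bound for the lower critical coupling\<close>

lemma kuramoto_field_norm_bound:
  assumes "0 < N"
  shows "4 * (\<Sum>i<N. (kuramoto_field N \<theta> $ i)\<^sup>2) \<le> real N ^ 3"
proof -
  define C S where "C = (\<Sum>j<N. cos (\<theta> $ j))" and "S = (\<Sum>j<N. sin (\<theta> $ j))"
  define R where "R = C\<^sup>2 + S\<^sup>2"
  \<comment> \<open>\<open>g i\<close> and \<open>f i\<close> are the real and imaginary parts of
    the order parameter \<open>C + i S\<close> rotated by the angle \<open>- \<theta> $ i\<close>.
    Cauchy-Schwarz is applied to \<open>g\<close>, whose sum is \<open>R\<close>.\<close>
  define f g where "f i = S * cos (\<theta> $ i) - C * sin (\<theta> $ i)"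
    and "g i = C * cos (\<theta> $ i) + S * sin (\<theta> $ i)" for i
  have field: "kuramoto_field N \<theta> $ i = f i" if "i < N" for i
    using that by (simp add: kuramoto_field_def f_def C_def S_def sin_diff sum_subtractf
        sum_distrib_left sum_distrib_right mult_ac)
  have pyth: "(f i)\<^sup>2 + (g i)\<^sup>2 = R" for i
  proof -
    have "(f i)\<^sup>2 + (g i)\<^sup>2 = R * ((sin (\<theta> $ i))\<^sup>2 + (cos (\<theta> $ i))\<^sup>2)"
    proof -
      have "(S * c - C * s)\<^sup>2 + (C * c + S * s)\<^sup>2 = (C\<^sup>2 + S\<^sup>2) * (s\<^sup>2 + c\<^sup>2)" for c s :: real
        by (simp add: power2_eq_square algebra_simps)
      then show ?thesis
        by (simp only: f_def g_def R_def)
    qed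
    then show ?thesis by simp
  qed
  have "(\<Sum>i<N. g i) = R"
    by (simp add: g_def R_def C_def S_def sum.distrib sum_distrib_left[symmetric] power2_eq_square)
  then have "R\<^sup>2 \<le> real N * (\<Sum>i<N. (g i)\<^sup>2)"
    using sum_squared_le_sum_of_squares[of g "{..<N}"] by (simp add: mult.commute)
  moreover have "(\<Sum>i<N. (f i)\<^sup>2) + (\<Sum>i<N. (g i)\<^sup>2) = real N * R"
    by (simp add: sum.distrib[symmetric] pyth)
  then have "(\<Sum>i<N. (g i)\<^sup>2) = real N * R - (\<Sum>i<N. (f i)\<^sup>2)"
    by simp
  ultimately have "R\<^sup>2 \<le> real N * (real N * R - (\<Sum>i<N. (f i)\<^sup>2))"
    by simp
  then have "4 * (real N * (\<Sum>i<N. (f i)\<^sup>2)) \<le> 4 * ((real N)\<^sup>2 * R - R\<^sup>2)"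
    by (simp add: algebra_simps power2_eq_square)
  \<comment> \<open>Completing the square in \<open>R\<close>; the dropped square vanishes at
    \<open>R = N^2 / 2\<close>.\<close>
  also have "\<dots> = ((real N)\<^sup>2)\<^sup>2 - ((real N)\<^sup>2 - 2 * R)\<^sup>2"
    by (simp add: power2_eq_square algebra_simps)
  also have "\<dots> \<le> real N * real N ^ 3"
    by (simp add: power2_eq_square power3_eq_cube)
  finally have "real N * (4 * (\<Sum>i<N. (f i)\<^sup>2)) \<le> real N * real N ^ 3"
    by simp
  then show ?thesis
    using assms field by simp
qed

lemma two_powr_neg_three_halves:
  assumes "0 < N"
  shows "2 * real N powr (- 3 / 2) = 2 / sqrt (real N ^ 3)"
proof -
  have "real N powr (3 / 2) = (real N powr 3) powr (1 / 2)"
    by (simp only: powr_powr) simp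
  also have "\<dots> = sqrt (real N ^ 3)"
    using assms by (simp add: powr_half_sqrt)
  finally show ?thesis
    by (simp add: powr_minus_divide)
qed

lemma gamma_min_ge:
  assumes N: "0 < N"
  shows "ereal (2 * real N powr (- 3 / 2)) \<le> gamma_min N"
  unfolding gamma_min_def critical_coupling_def
proof (intro INF_greatest, clarify)
  fix \<omega> and \<gamma> :: real and \<theta>
  assume "\<omega> \<in> unit_frequencies N" "0 < \<gamma>" and sync: "fully_synchronous N \<gamma> \<omega> \<theta>"
  then have \<omega>: "\<omega> \<in> carrier_vec N" "(\<Sum>i<N. (\<omega> $ i)\<^sup>2) = 1"
    by (auto simp: unit_frequencies_def)
  have coord: "(\<gamma> \<cdot>\<^sub>v kuramoto_field N \<theta>) $ i = (- \<omega>) $ i" for i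
    using sync by (simp add: fully_synchronous_def)
  have "\<gamma> * kuramoto_field N \<theta> $ i = - \<omega> $ i" if "i < N" for i
    using that \<omega> coord[of i] by simp
  then have "(\<Sum>i<N. (\<gamma> * kuramoto_field N \<theta> $ i)\<^sup>2) = 1"
    using \<omega> by simp
  then have "4 = \<gamma>\<^sup>2 * (4 * (\<Sum>i<N. (kuramoto_field N \<theta> $ i)\<^sup>2))"
    by (simp add: power_mult_distrib sum_distrib_left[symmetric])
  also have "\<dots> \<le> \<gamma>\<^sup>2 * real N ^ 3"
    using kuramoto_field_norm_bound[OF N] by (intro mult_left_mono) auto
  finally have "sqrt 4 \<le> sqrt (\<gamma>\<^sup>2 * real N ^ 3)"
    by (rule real_sqrt_le_mono)
  then have "2 / sqrt (real N ^ 3) \<le> \<gamma>"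
    using N \<open>0 < \<gamma>\<close> by (simp add: real_sqrt_mult field_simps)
  then show "ereal (2 * real N powr (- 3 / 2)) \<le> ereal \<gamma>"
    using two_powr_neg_three_halves[OF N] by simp
qed

section \<open>Upper bounds for the lower critical coupling from two clusters\<close>

text \<open>Every cohesive state with nonzero field is synchronous for the frequency vector
  \<open>- f / |f|\<close> at coupling \<open>1 / |f|\<close>, so it remains to make
  \<open>|f|\<close> large among cohesive states.\<close>

lemma gamma_min_le_cohesive:
  assumes \<theta>: "\<theta> \<in> carrier_vec N" and N: "0 < N"
    and cohesive: "\<And>i j. i < N \<Longrightarrow> j < N \<Longrightarrow> \<bar>\<theta> $ i - \<theta> $ j\<bar> < pi / 2"
    and norm: "(\<Sum>i<N. (kuramoto_field N \<theta> $ i)\<^sup>2) = s\<^sup>2" "0 < s"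
  shows "gamma_min N \<le> ereal (1 / s)"
proof -
  define \<omega> where "\<omega> = (- 1 / s) \<cdot>\<^sub>v kuramoto_field N \<theta>"
  have \<omega>_index: "\<omega> $ i = - (1 / s) * kuramoto_field N \<theta> $ i" if "i < N" for i
    using that by (simp add: \<omega>_def)
  have "(\<Sum>i<N. (\<omega> $ i)\<^sup>2) = (\<Sum>i<N. (1 / s)\<^sup>2 * (kuramoto_field N \<theta> $ i)\<^sup>2)"
    by (intro sum.cong) (auto simp: \<omega>_index power_mult_distrib power_divide)
  also have "\<dots> = 1"
    using norm by (simp add: sum_distrib_left[symmetric] sum_divide_distrib[symmetric] power_divide)
  finally have unit: "(\<Sum>i<N. (\<omega> $ i)\<^sup>2) = 1" .
  have "(\<Sum>i<N. kuramoto_field N \<theta> $ i) = (\<Sum>i<N. \<Sum>j<N. sin (\<theta> $ j - \<theta> $ i))"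
    by (simp add: kuramoto_field_def)
  also have "\<dots> = (\<Sum>j<N. \<Sum>i<N. sin (\<theta> $ j - \<theta> $ i))"
    by (rule sum.swap)
  also have "\<dots> = 0"
    by (rule sum_sin_antisymmetric)
  finally have "(\<Sum>i<N. \<omega> $ i) = 0"
    by (simp add: \<omega>_index sum_distrib_left[symmetric] sum_negf sum_divide_distrib[symmetric])
  with unit have "\<omega> \<in> unit_frequencies N"
    by (simp add: unit_frequencies_def \<omega>_def)
  moreover have "fully_synchronous N (1 / s) \<omega> \<theta>"
    using cohesive_jacobian[OF \<theta> N cohesive] \<theta>
    by (auto simp: fully_synchronous_def \<omega>_def intro!: eq_vecI)
  then have "critical_coupling N \<omega> \<le> ereal (1 / s)"
    unfolding critical_coupling_def using norm by (intro INF_lower) auto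
  ultimately show ?thesis
    unfolding gamma_min_def by (rule INF_lower2)
qed

text \<open>Two clusters at an angle \<open>\<phi> < \<pi> / 2\<close> are cohesive; the bound is the limit \<open>\<phi> \<rightarrow> \<pi> / 2\<close>.\<close>

lemma gamma_min_le_two_clusters:
  assumes m: "0 < m" "m < N"
  shows "gamma_min N \<le> ereal (1 / sqrt (real m * (real N - real m) * real N))"
proof -
  \<comment> \<open>\<open>K\<close> is the norm of the field at angle \<open>pi / 2\<close>:
    \<open>m\<close> entries of size \<open>N - m\<close> and \<open>N - m\<close> entries of size
    \<open>m\<close> give \<open>m (N - m)^2 + (N - m) m^2 = m (N - m) N\<close>.\<close>
  define K where "K = sqrt (real m * (real N - real m) * real N)"
  have K: "0 < K" "K\<^sup>2 = real m * (real N - real m) * real N"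
    using m by (auto simp: K_def)
  have bound: "gamma_min N \<le> ereal (1 / (K * sin \<phi>))" if \<phi>: "0 < \<phi>" "\<phi> < pi / 2" for \<phi> :: real
  proof (rule gamma_min_le_cohesive)
    let ?\<theta> = "vec N (\<lambda>i. if i < m then \<phi> else 0)"
    have split: "{..<N} = {..<m} \<union> {m..<N}"
      using m by auto
    have sum_split: "(\<Sum>i<N. if i < m then a else b) = real m * a + (real N - real m) * b" for a b
      using m by (subst split, subst sum.union_disjoint) (auto simp: of_nat_diff)
    have field: "kuramoto_field N ?\<theta> $ i =
        (if i < m then - (real N - real m) * sin \<phi> else real m * sin \<phi>)" if "i < N" for i
    proof -
      have "kuramoto_field N ?\<theta> $ i = (\<Sum>j<N. if j < m then (if i < m then 0 else sin \<phi>)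
          else (if i < m then - sin \<phi> else 0))"
        using that by (auto simp: kuramoto_field_def intro!: sum.cong)
      then show ?thesis
        by (cases "i < m") (simp_all add: sum_split algebra_simps)
    qed
    have "(\<Sum>i<N. (kuramoto_field N ?\<theta> $ i)\<^sup>2) =
        (\<Sum>i<N. if i < m then ((real N - real m) * sin \<phi>)\<^sup>2 else (real m * sin \<phi>)\<^sup>2)"
      by (intro sum.cong) (auto simp: field power_mult_distrib power2_commute[of "real m"])
    also have "\<dots> = (K * sin \<phi>)\<^sup>2"
      unfolding sum_split by (simp add: power_mult_distrib K) (simp add: power2_eq_square algebra_simps)
    finally show "(\<Sum>i<N. (kuramoto_field N ?\<theta> $ i)\<^sup>2) = (K * sin \<phi>)\<^sup>2" .
    show "0 < K * sin \<phi>"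
      using K \<phi> by (intro mult_pos_pos sin_gt_zero) auto
    show "\<bar>?\<theta> $ i - ?\<theta> $ j\<bar> < pi / 2" if "i < N" "j < N" for i j
      using that \<phi> by auto
  qed (use m in auto)
  have "((\<lambda>\<phi>. 1 / (K * sin \<phi>)) \<longlongrightarrow> 1 / (K * sin (pi / 2))) (at_left (pi / 2))"
    using K by (intro tendsto_intros) auto
  then have "((\<lambda>\<phi>. ereal (1 / (K * sin \<phi>))) \<longlongrightarrow> ereal (1 / K)) (at_left (pi / 2))"
    by simp
  moreover have "\<forall>\<^sub>F \<phi> in at_left (pi / 2). gamma_min N \<le> ereal (1 / (K * sin \<phi>))"
    by (rule eventually_mono[OF eventually_at_left_real[OF pi_half_gt_zero]]) (auto intro: bound)
  ultimately show ?thesis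
    unfolding K_def[symmetric] by (rule tendsto_lowerbound) simp
qed

text \<open>Clusters of size \<open>N / 2\<close> turn \<open>m (N - m) N\<close> into
  \<open>N^3 / 4\<close>, where the two-cluster bound meets the lower bound.\<close>

lemma gamma_min_even:
  assumes "2 \<le> N" "even N"
  shows "gamma_min N = ereal (2 * real N powr (- 3 / 2))"
proof (rule antisym)
  obtain m where m: "N = 2 * m"
    using assms by blast
  have K: "real m * (real N - real m) * real N = real N ^ 3 / 4"
    by (simp add: m power3_eq_cube)
  have "0 < N"
    using assms by simp
  then have "1 / sqrt (real m * (real N - real m) * real N) = 2 * real N powr (- 3 / 2)"
    unfolding K using two_powr_neg_three_halves[of N] by (simp add: real_sqrt_divide)
  then show "gamma_min N \<le> ereal (2 * real N powr (- 3 / 2))"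
    using gamma_min_le_two_clusters[of m N] m assms by simp
qed (use assms gamma_min_ge in auto)

text \<open>Clusters of sizes \<open>m\<close> and \<open>m + 1\<close> give
  \<open>N (N^2 - 1) / 4\<close> instead of \<open>N^3 / 4\<close>, which costs at most a factor
  \<open>1 + 1 / N\<close>.\<close>

lemma gamma_min_odd_le:
  assumes N: "2 \<le> N" "odd N"
  shows "gamma_min N \<le> ereal (2 * real N powr (- 3 / 2) + 2 * real N powr (- 5 / 2))"
proof -
  obtain m where m: "N = 2 * m + 1"
    using N by (elim oddE)
  define x where "x = real N"
  have x: "2 \<le> x" "0 < x ^ 3"
    using N by (auto simp: x_def)
  have K: "real m * (real N - real m) * real N = x * (x\<^sup>2 - 1) / 4"
    by (simp add: m x_def power2_eq_square algebra_simps)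
  have "4 \<le> x\<^sup>2"
    using x power_mono[of 2 x 2] by simp
  have "x ^ 3 \<le> (1 + 1 / x)\<^sup>2 * (x * (x\<^sup>2 - 1))"
  proof -
    have "(1 + 1 / x)\<^sup>2 * (x * (x\<^sup>2 - 1)) = x ^ 3 + (2 * x\<^sup>2 - 2 - 1 / x)"
      using x by (simp add: field_simps power2_eq_square power3_eq_cube)
    moreover have "1 / x \<le> 1"
      using x by simp
    ultimately show ?thesis
      using \<open>4 \<le> x\<^sup>2\<close> by linarith
  qed
  then have "sqrt (x ^ 3) \<le> sqrt ((1 + 1 / x)\<^sup>2 * (x * (x\<^sup>2 - 1)))"
    by (rule real_sqrt_le_mono)
  also have "\<dots> = (1 + 1 / x) * sqrt (x * (x\<^sup>2 - 1))"
    using x by (simp add: real_sqrt_mult)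
  finally have "sqrt (x ^ 3) \<le> (1 + 1 / x) * sqrt (x * (x\<^sup>2 - 1))" .
  moreover have "2 / b \<le> 2 / a * c" if "a \<le> c * b" "0 < a" "0 < b" for a b c :: real
    using that by (simp add: field_simps)
  moreover have "0 < sqrt (x ^ 3)" "0 < sqrt (x * (x\<^sup>2 - 1))"
    using x \<open>4 \<le> x\<^sup>2\<close> by simp_all
  ultimately have "2 / sqrt (x * (x\<^sup>2 - 1)) \<le> 2 / sqrt (x ^ 3) * (1 + 1 / x)"
    by blast
  also have "2 / sqrt (x ^ 3) = 2 * x powr (- 3 / 2)"
    using N two_powr_neg_three_halves[of N] by (simp add: x_def)
  also have "\<dots> * (1 + 1 / x) = 2 * x powr (- 3 / 2) + 2 * x powr (- 5 / 2)"
  proof -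
    have "x powr (- 5 / 2) = x powr (- 3 / 2) / x"
      using x powr_diff[of x "- 3 / 2" 1] by simp
    then show ?thesis
      by (simp add: algebra_simps)
  qed
  finally have "1 / sqrt (real m * (real N - real m) * real N) \<le>
      2 * real N powr (- 3 / 2) + 2 * real N powr (- 5 / 2)"
    by (simp add: K real_sqrt_divide x_def)
  then show ?thesis
    using gamma_min_le_two_clusters[of m N] m N by (simp add: order_trans)
qed

section \<open>The remainder for odd \<open>N\<close> and the combined statement\<close>

theorem theorem3p3:
  shows "(\<forall>N\<ge>2. even N \<longrightarrow> gamma_min N = ereal (2 * real N powr (- 3 / 2))) \<and>
    (\<exists>r :: nat \<Rightarrow> real.
       r \<in> O[inf at_top (principal {N. odd N})](\<lambda>N. real N powr (- 5 / 2)) \<and>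
       (\<forall>N\<ge>2. odd N \<longrightarrow> gamma_min N = ereal (2 * real N powr (- 3 / 2) + r N))) \<and>
    (\<forall>N\<ge>2. ereal (1 / sqrt (real N * (real N - 1))) \<le> gamma_max N \<and>
           gamma_max N \<le> ereal (sqrt 2 / sqrt (real N * (real N - 1))))"
proof (intro conjI)
  define r where "r N = real_of_ereal (gamma_min N) - 2 * real N powr (- 3 / 2)" for N
  \<comment> \<open>Both bounds are real, so \<open>gamma_min N\<close> is finite here and
    \<open>real_of_ereal\<close> returns its true value rather than the default
    \<open>0\<close>.\<close>
  have r: "gamma_min N = ereal (2 * real N powr (- 3 / 2) + r N) \<and> 0 \<le> r N \<and>
      r N \<le> 2 * real N powr (- 5 / 2)" if "2 \<le> N" "odd N" for N
    using gamma_min_ge[of N] gamma_min_odd_le[OF that] that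
    by (cases "gamma_min N") (auto simp: r_def)
  have "\<forall>\<^sub>F N in inf at_top (principal {N. odd N}).
      norm (r N) \<le> 2 * norm (real N powr (- 5 / 2))"
    unfolding eventually_inf_principal
    using eventually_ge_at_top[of 2] by eventually_elim (use r in auto)
  then have "r \<in> O[inf at_top (principal {N. odd N})](\<lambda>N. real N powr (- 5 / 2))"
    by (rule bigoI)
  with r show "\<exists>r :: nat \<Rightarrow> real.
       r \<in> O[inf at_top (principal {N. odd N})](\<lambda>N. real N powr (- 5 / 2)) \<and>
       (\<forall>N\<ge>2. odd N \<longrightarrow> gamma_min N = ereal (2 * real N powr (- 3 / 2) + r N))"
    by blast
qed (use gamma_min_even gamma_max_ge gamma_max_le in blast)+

end
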